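(* Let $G$ be a finite non-cyclic nilpotent group. Then the non-cyclic graph $\Gamma(G)$ does not admit a total perfect code.
   Context: For a finite non-cyclic group $G$, $\mathrm{Cyc}(G)=\{x\in G:\langle x,y\rangle\text{ is cyclic for all }y\in G\}$. The non-cyclic graph $\Gamma(G)$ is the simple undirected graph with vertex set $G\setminus\mathrm{Cyc}(G)$ in which two distinct vertices $x,y$ are adjacent if and only if the subgroup $\langle x,y\rangle$ is not cyclic. A total perfect code of a graph $\Gamma$ is a subset $T\subseteq V(\Gamma)$ such that every vertex of $\Gamma$ (including those in $T$) is adjacent to exactly one vertex in $T$. *)

theory Defs
  imports "HOL-Algebra.Algebra" "Graph_Theory.Pair_Digraph"
begin

text \<open>The commutator convention is that of \<^const>\<open>derived_set\<close>. The series is indexed from 0, so the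
  n-th term here is the term usually written with index n + 1.\<close>

primrec lower_central_series :: "('a, 'b) monoid_scheme \<Rightarrow> nat \<Rightarrow> 'a set" where
  "lower_central_series G 0 = carrier G"
| "lower_central_series G (Suc n) =
     generate G (\<Union>x \<in> lower_central_series G n. \<Union>y \<in> carrier G.
       { x \<otimes>\<^bsub>G\<^esub> y \<otimes>\<^bsub>G\<^esub> (inv\<^bsub>G\<^esub> x) \<otimes>\<^bsub>G\<^esub> (inv\<^bsub>G\<^esub> y) })"

definition nilpotent_group :: "('a, 'b) monoid_scheme \<Rightarrow> bool" where
  "nilpotent_group G \<longleftrightarrow> group G \<and> (\<exists>n. lower_central_series G n = {\<one>\<^bsub>G\<^esub>})"

definition Cyc :: "('a, 'b) monoid_scheme \<Rightarrow> 'a set" where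
  "Cyc G = {x \<in> carrier G. \<forall>y \<in> carrier G. cyclic_group (subgroup_generated G {x, y})}"

text \<open>A simple undirected graph is represented as in the locale \<^locale>\<open>pair_graph\<close>: an edge is a
  symmetric pair of arcs.\<close>

definition noncyclic_graph :: "('a, 'b) monoid_scheme \<Rightarrow> 'a pair_pre_digraph" where
  "noncyclic_graph G =
     \<lparr> pverts = carrier G - Cyc G,
       parcs = {(x, y). x \<in> carrier G - Cyc G \<and> y \<in> carrier G - Cyc G \<and> x \<noteq> y \<and>
                  \<not> cyclic_group (subgroup_generated G {x, y})} \<rparr>"

definition total_perfect_code :: "'a pair_pre_digraph \<Rightarrow> 'a set \<Rightarrow> bool" where
  "total_perfect_code \<Gamma> T \<longleftrightarrow>
     T \<subseteq> pverts \<Gamma> \<and> (\<forall>v \<in> pverts \<Gamma>. \<exists>!u. u \<in> T \<and> (v, u) \<in> parcs \<Gamma>)"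

lemma pair_graph_noncyclic_graph:
  assumes "finite (carrier G)"
  shows "pair_graph (noncyclic_graph G)"
proof -
  have "finite (parcs (noncyclic_graph G))"
    by (rule finite_subset[of _ "carrier G \<times> carrier G"])
      (use assms in \<open>auto simp: noncyclic_graph_def\<close>)
  then show ?thesis
    using assms
    by unfold_locales
      (auto simp: noncyclic_graph_def insert_commute symmetric_def sym_def arcs_ends_def arc_to_ends_def)
qed

end

theory Submission
  imports Defs
begin

text \<open>A vertex has a neighbour \<open>a\<close> in the code, and \<open>a\<close> in turn has a
  neighbour \<open>b\<close> in the code. Since \<open>\<langle>a, ab\<rangle> = \<langle>b, ab\<rangle> = \<langle>a, b\<rangle>\<close>, the vertex \<open>ab\<close> is adjacent to both.
  It remains to see that there is a vertex at all: if every two elements generate a cyclic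
  subgroup, then an element whose cyclic subgroup is as large as possible generates the group.\<close>

context group
begin

text \<open>\<open>cyclic_group\<close> places its generator inside the record
  \<open>subgroup_generated G S\<close>. Generation within a subgroup agrees with generation in
  \<open>G\<close>, so the witness can be moved to \<open>G\<close>, where cardinalities of
  \<open>generate G {z}\<close> are compared.\<close>

lemma cyclic_subgroup_generatedE:
  assumes "S \<subseteq> carrier G" "cyclic_group (subgroup_generated G S)"
  obtains z where "z \<in> carrier G" "generate G {z} = generate G S"
proof -
  obtain z where z: "z \<in> carrier (subgroup_generated G S)"
    and eq: "subgroup_generated (subgroup_generated G S) {z} = subgroup_generated G S"
    using assms(2) by (auto simp: cyclic_group_def)
  have carr: "carrier (subgroup_generated G S) = generate G S"
    using assms(1) by (simp add: carrier_subgroup_generated Int_absorb1)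
  have "generate (subgroup_generated G S) {z} = generate G {z}"
    unfolding subgroup_generated_def using assms(1) z carr
    by (simp add: Int_absorb1 generate_consistent generate_is_subgroup)
  moreover have "generate (subgroup_generated G S) {z} = generate G S"
    using arg_cong[OF eq, of carrier] z carr by (simp add: carrier_subgroup_generated)
  moreover have "z \<in> carrier G"
    using z carr generate_in_carrier[OF assms(1)] by blast
  ultimately show thesis
    using that by metis
qed

lemma cyclic_group_if_pairwise_cyclic:
  assumes fin: "finite (carrier G)"
    and pairs: "\<And>x y. \<lbrakk>x \<in> carrier G; y \<in> carrier G\<rbrakk> \<Longrightarrow> cyclic_group (subgroup_generated G {x, y})"
  shows "cyclic_group G"
proof -
  let ?N = "(\<lambda>z. card (generate G {z})) ` carrier G"
  have "Max ?N \<in> ?N"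
    using fin by (intro Max_in) auto
  then obtain x where x: "x \<in> carrier G" and "card (generate G {x}) = Max ?N"
    by auto
  then have max: "card (generate G {z}) \<le> card (generate G {x})" if "z \<in> carrier G" for z
    using fin that by simp
  have "y \<in> generate G {x}" if y: "y \<in> carrier G" for y
  proof -
    \<comment> \<open>The cyclic group \<langle>x, y\<rangle> = \<langle>z\<rangle> contains
      \<langle>x\<rangle> and, by the choice of \<open>x\<close>, is no larger; by finiteness the
      two coincide.\<close>
    obtain z where z: "z \<in> carrier G" "generate G {z} = generate G {x, y}"
      using cyclic_subgroup_generatedE[of "{x, y}"] pairs x y by auto
    have "finite (generate G {x, y})"
      using generate_incl[of "{x, y}"] fin x y finite_subset by auto
    moreover have "generate G {x} \<subseteq> generate G {x, y}"
      by (rule mono_generate) auto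
    moreover have "card (generate G {x, y}) \<le> card (generate G {x})"
      using max[OF z(1)] z(2) by simp
    ultimately have "generate G {x} = generate G {x, y}"
      by (rule card_seteq)
    then show ?thesis
      by (simp add: generate.incl)
  qed
  then have "carrier (subgroup_generated G {x}) = carrier G"
    using x generate_incl[of "{x}"] by (auto simp: carrier_subgroup_generated)
  \<comment> \<open>\<open>subgroup_generated\<close> changes only the carrier field, so equal
    carriers give equal records.\<close>
  then have "subgroup_generated G {x} = G"
    by (metis carrier_subgroup_generated subgroup_generated_def partial_object.surjective partial_object.update_convs(1))
  then show ?thesis
    using x by (auto simp: cyclic_group_def)
qed

lemma generate_mult_left:
  assumes "a \<in> carrier G" "b \<in> carrier G"
  shows "generate G {a, a \<otimes> b} = generate G {a, b}"
proof (intro equalityI generate_subgroup_incl generate_is_subgroup)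
  show "{a, a \<otimes> b} \<subseteq> generate G {a, b}"
    by (auto intro: generate.intros)
  \<comment> \<open>This product is \<open>b\<close>, recovered from \<open>a\<close> and
    \<open>a \<otimes> b\<close>.\<close>
  have "inv a \<otimes> (a \<otimes> b) \<in> generate G {a, a \<otimes> b}"
    by (auto intro: generate.intros)
  then show "{a, b} \<subseteq> generate G {a, a \<otimes> b}"
    using assms by (auto intro: generate.intros simp: m_assoc[symmetric])
qed (use assms in auto)

lemma generate_mult_right:
  assumes "a \<in> carrier G" "b \<in> carrier G"
  shows "generate G {b, a \<otimes> b} = generate G {a, b}"
proof (intro equalityI generate_subgroup_incl generate_is_subgroup)
  show "{b, a \<otimes> b} \<subseteq> generate G {a, b}"
    by (auto intro: generate.intros)
  have "(a \<otimes> b) \<otimes> inv b \<in> generate G {b, a \<otimes> b}"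
    by (auto intro: generate.intros)
  then show "{a, b} \<subseteq> generate G {b, a \<otimes> b}"
    using assms by (auto intro: generate.intros simp: m_assoc)
qed (use assms in auto)

text \<open>A non-cyclic \<langle>x, y\<rangle> itself keeps both \<open>x\<close> and
  \<open>y\<close> out of \<open>Cyc G\<close>, and it forces \<open>x \<noteq> y\<close> because a
  single element generates a cyclic group.\<close>

lemma parcs_noncyclic_graph_iff:
  "(x, y) \<in> parcs (noncyclic_graph G) \<longleftrightarrow>
    x \<in> carrier G \<and> y \<in> carrier G \<and> \<not> cyclic_group (subgroup_generated G {x, y})"
  using cyclic_group_generated[of x]
  by (auto simp: noncyclic_graph_def Cyc_def insert_commute)

lemma noncyclic_graph_common_neighbour:
  assumes "(a, b) \<in> parcs (noncyclic_graph G)"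
  shows "(a \<otimes> b, a) \<in> parcs (noncyclic_graph G)" "(a \<otimes> b, b) \<in> parcs (noncyclic_graph G)"
  using assms generate_mult_left[of a b] generate_mult_right[of a b]
  by (auto simp: parcs_noncyclic_graph_iff subgroup_generated_def insert_commute)

text \<open>Excludes the degenerate case: in a graph without vertices the empty set is a total
  perfect code.\<close>

lemma pverts_noncyclic_graph_nonempty:
  assumes "finite (carrier G)" "\<not> cyclic_group G"
  shows "pverts (noncyclic_graph G) \<noteq> {}"
  using assms cyclic_group_if_pairwise_cyclic by (auto simp: noncyclic_graph_def Cyc_def)

lemma no_total_perfect_code_noncyclic_graph:
  assumes "finite (carrier G)" "\<not> cyclic_group G"
  shows "\<not> total_perfect_code (noncyclic_graph G) T"
proof
  assume "total_perfect_code (noncyclic_graph G) T"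
  then have T: "T \<subseteq> pverts (noncyclic_graph G)"
    and code: "\<And>v. v \<in> pverts (noncyclic_graph G) \<Longrightarrow>
      \<exists>!u. u \<in> T \<and> (v, u) \<in> parcs (noncyclic_graph G)"
    by (auto simp: total_perfect_code_def)
  obtain a where a: "a \<in> T"
    using code pverts_noncyclic_graph_nonempty[OF assms] by blast
  \<comment> \<open>Totality enters here: the code condition also applies to the code vertex
    \<open>a\<close>.\<close>
  then obtain b where b: "b \<in> T" and ab: "(a, b) \<in> parcs (noncyclic_graph G)"
    using code T by blast
  \<comment> \<open>Distinctness makes \<open>a\<close> and \<open>b\<close> two code neighbours of
    \<open>a \<otimes> b\<close>, against uniqueness.\<close>
  have "a \<noteq> b"
    using ab by (auto simp: noncyclic_graph_def)
  moreover have "a \<otimes> b \<in> pverts (noncyclic_graph G)"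
    using noncyclic_graph_common_neighbour(1)[OF ab] by (simp add: noncyclic_graph_def)
  ultimately show False
    using code a b noncyclic_graph_common_neighbour[OF ab] by blast
qed

end

theorem theorem4p4:
  fixes G :: "('a, 'b) monoid_scheme"
  assumes "group G"
    and "finite (carrier G)"
    and "\<not> cyclic_group G"
    and "nilpotent_group G"
  shows "\<not> (\<exists>T. total_perfect_code (noncyclic_graph G) T)"
  using group.no_total_perfect_code_noncyclic_graph[OF assms(1-3)] by blast

end
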